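(* Let $d\ge 1$. Let $G$ be the distribution function of a continuous real random variable $X$ whose density function is symmetric about $0$, let $Y$ be a continuous random variable with values in $\mathbb{R}^d$ and density function $f_0$, independent of $X$, and let $w:\mathbb{R}^d\to\mathbb{R}$ be a (measurable) function such that $w(Y)$ has a density symmetric about $0$. Suppose that there exists an invertible differentiable transformation $R:\mathbb{R}^d\to\mathbb{R}^d$ such that, for all $y\in\mathbb{R}^d$, $$f_0(y)=f_0[R(y)],\qquad |\det R'(y)|=1,\qquad w[R(y)]=-w(y),$$ where $R'(y)$ denotes the Jacobian matrix of partial derivatives of $R$ at $y$. Then the random variable $$Z=\begin{cases} Y & \text{if } X\le w(Y),\\ R^{-1}(Y) & \text{otherwise,}\end{cases}$$ has density function $f(z)=2\,f_0(z)\,G\{w(z)\}$, $z\in\mathbb{R}^d$.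
   Context: A "continuous" random variable is one whose distribution is absolutely continuous with respect to Lebesgue measure, i.e. one that has a density function. A density $g$ on $\mathbb{R}$ is symmetric about $0$ if $g(-x)=g(x)$; then its distribution function $G$ satisfies $G(-x)=1-G(x)$. *)

theory Defs
  imports "HOL-Probability.Probability"
begin

text \<open>
  A random variable is continuous if it has a density with respect to \<^const>\<open>lborel\<close>. The library
  predicate \<^const>\<open>distributed\<close> takes densities with values in \<^typ>\<open>ennreal\<close>, whereas here densities
  are real-valued functions; nonnegativity must be required because \<^const>\<open>ennreal\<close> maps negative
  reals to 0.
\<close>

definition has_density :: "'m measure \<Rightarrow> ('m \<Rightarrow> 'b::euclidean_space) \<Rightarrow> ('b \<Rightarrow> real) \<Rightarrow> bool" where
  "has_density M X f \<longleftrightarrow> (\<forall>x. 0 \<le> f x) \<and> distributed M lborel X (\<lambda>x. ennreal (f x))"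

definition symmetric_about_0 :: "(real \<Rightarrow> real) \<Rightarrow> bool" where
  "symmetric_about_0 g \<longleftrightarrow> (\<forall>x. g (- x) = g x)"

text \<open>
  The library constant \<^const>\<open>prob_space.indep_var\<close> forces both random variables to have the
  same value type, so independence is stated here through the generated \<open>\<sigma>\<close>-algebras.
\<close>

definition indep_rv :: "'m measure \<Rightarrow> ('m \<Rightarrow> 'a::topological_space) \<Rightarrow> ('m \<Rightarrow> 'b::topological_space) \<Rightarrow> bool" where
  "indep_rv M X Y \<longleftrightarrow>
     prob_space.indep_set M {X -` A \<inter> space M |A. A \<in> sets borel} {Y -` B \<inter> space M |B. B \<in> sets borel}"

end

theory Submission
  imports Defs
begin

text \<open>
  By independence, \<open>P(Z \<in> A)\<close> is the integral of \<open>f\<^sub>0(y) G(w(y))\<close> over \<open>A\<close> plus the integral of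
  \<open>f\<^sub>0(y) (1 - G(w(y)))\<close> over \<open>R(A)\<close>. By symmetry \<open>1 - G(w(y)) = G(- w(y))\<close>, and \<open>R\<close> preserves both
  Lebesgue measure and \<open>f\<^sub>0\<close> while changing the sign of \<open>w\<close>, so the substitution \<open>y = R(z)\<close> turns
  the second integral into the first. Measurability of \<open>R\<^sup>-\<^sup>1\<close> comes from invariance of domain.
\<close>

section \<open>Well-ordered copies of finite index types\<close>

text \<open>
  The library states the change of variables formula only for well-ordered index types. An arbitrary
  finite index type is transferred to a well-ordered copy of itself.
\<close>

typedef (overloaded) 'a ordered_copy = "UNIV :: 'a::finite set" by simp

instance ordered_copy :: (finite) finite
proof
  have "(UNIV :: 'a ordered_copy set) = range Abs_ordered_copy"
    by (metis Abs_ordered_copy_cases UNIV_eq_I rangeI)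
  then show "finite (UNIV :: 'a ordered_copy set)"
    by (metis finite finite_imageI)
qed

text \<open>A finite type carries no canonical order, so some injection into \<open>nat\<close> is
  fixed. The order pulled back along it is linear and well-founded, and nothing else about it
  matters.\<close>

definition enumeration :: "'a::finite ordered_copy \<Rightarrow> nat" where
  "enumeration = (SOME e. inj e)"

lemma inj_enumeration: "inj (enumeration :: 'a::finite ordered_copy \<Rightarrow> nat)"
proof -
  have "\<exists>e :: 'a ordered_copy \<Rightarrow> nat. inj e"
    using finite_imp_inj_to_nat_seg[OF finite[of "UNIV :: 'a ordered_copy set"]] by blast
  then show ?thesis
    unfolding enumeration_def by (rule someI_ex)
qed

instantiation ordered_copy :: (finite) linorder
begin
definition "x \<le> y \<longleftrightarrow> enumeration x \<le> enumeration y"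
definition "x < y \<longleftrightarrow> enumeration x < enumeration y"
instance
  by standard
    (auto simp: less_eq_ordered_copy_def less_ordered_copy_def dest: injD[OF inj_enumeration])
end

instance ordered_copy :: (finite) wellorder
proof (rule wf_wellorderI)
  have "{(x :: 'a ordered_copy, y). x < y} = inv_image less_than enumeration"
    by (auto simp: inv_image_def less_ordered_copy_def)
  then show "wf {(x :: 'a ordered_copy, y). x < y}"
    by (simp only: wf_inv_image wf_less_than)
  show "OFCLASS('a ordered_copy, linorder_class)" by intro_classes
qed

lemma bij_Rep_ordered_copy: "bij Rep_ordered_copy"
  by (metis Rep_ordered_copy_inject UNIV_I bijI' Rep_ordered_copy_cases)

lemma bij_Abs_ordered_copy: "bij Abs_ordered_copy"
  by (metis Abs_ordered_copy_inject UNIV_I bijI' Abs_ordered_copy_cases)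

section \<open>Determinant and Lebesgue measure under relabelling of coordinates\<close>

text \<open>Conjugation by \<open>r\<close> sends the permutations of \<open>'a\<close> bijectively
  and sign-preservingly to those of \<open>'b\<close>. It matches the two Leibniz sums term by
  term.\<close>

lemma det_reindex:
  fixes A :: "'c::comm_ring_1 ^ 'b::finite ^ 'b" and r :: "'a::finite \<Rightarrow> 'b"
  assumes r: "bij r"
  shows "det (\<chi> i j. A $ r i $ r j) = det A"
proof -
  have perm: "bij_betw (\<lambda>p x. if x \<in> UNIV then r (p (inv r x)) else x)
      {p. p permutes UNIV} {p. p permutes UNIV}"
    by (rule bij_betw_permutations[OF r])
  have sgn: "sign (\<lambda>x. r (p (inv r x))) = sign p" if "p permutes UNIV" for p
  proof -
    have "map_permutation UNIV r p = (\<lambda>x. r (p (inv r x)))"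
      using r by (auto simp: map_permutation_def restrict_id_def bij_def)
    then show ?thesis
      using sign_map_permutation[of r UNIV p] r that by (simp add: bij_def)
  qed
  have prod: "(\<Prod>i\<in>UNIV. A $ i $ r (p (inv r i))) = (\<Prod>i\<in>UNIV. A $ r i $ r (p i))" for p
    using prod.reindex_bij_betw[OF r, of "\<lambda>i. A $ i $ r (p (inv r i))"] r
    by (simp add: bij_def)
  have "det A = (\<Sum>p | p permutes UNIV. of_int (sign (\<lambda>x. r (p (inv r x)))) *
      (\<Prod>i\<in>UNIV. A $ i $ r (p (inv r i))))"
    unfolding det_def using sum.reindex_bij_betw[OF perm, symmetric,
      of "\<lambda>p. of_int (sign p) * (\<Prod>i\<in>UNIV. A $ i $ p i)"] by simp
  also have "\<dots> = det (\<chi> i j. A $ r i $ r j)"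
    unfolding det_def by (intro sum.cong) (simp_all add: sgn prod)
  finally show ?thesis ..
qed

lemma prod_Basis_vec: "(\<Prod>b\<in>Basis. (v :: real ^ 'n) \<bullet> b) = (\<Prod>i\<in>UNIV. v $ i)"
proof -
  have *: "(Basis :: (real ^ 'n) set) = range (\<lambda>i. axis i 1)"
    by (auto simp: Basis_vec_def)
  show ?thesis
    unfolding * by (subst prod.reindex) (simp_all add: inj_on_def axis_eq_axis inner_axis)
qed

text \<open>Boxes determine Lebesgue measure. The preimage of a box is the box with its sides
  relabelled, and the product of the side lengths does not depend on their order.\<close>

lemma distr_lborel_reindex:
  fixes r :: "'a::finite \<Rightarrow> 'b::finite"
  assumes r: "bij r"
  shows "distr lborel borel (\<lambda>x :: real ^ 'b. \<chi> i. x $ r i) = lborel"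
proof (rule lborel_eqI[symmetric])
  fix l u :: "real ^ 'a"
  assume le: "\<And>b. b \<in> Basis \<Longrightarrow> l \<bullet> b \<le> u \<bullet> b"
  let ?e = "\<lambda>x :: real ^ 'a. (\<chi> i. x $ inv r i) :: real ^ 'b"
  have le': "l $ i \<le> u $ i" for i
    using le[of "axis i 1"] by (auto simp: Basis_vec_def inner_axis)
  have meas: "(\<lambda>x :: real ^ 'b. \<chi> i. x $ r i) \<in> borel_measurable lborel"
    by (auto intro!: borel_measurable_continuous_onI linear_continuous_on
      simp: linear_conv_bounded_linear[symmetric] linear_iff vec_eq_iff)
  have "(\<lambda>x :: real ^ 'b. \<chi> i. x $ r i) -` box l u = box (?e l) (?e u)"
  proof -
    have *: "(\<forall>i. P i (r i)) \<longleftrightarrow> (\<forall>i. P (inv r i) i)" for P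
      using r by (metis bij_inv_eq_iff)
    show ?thesis
    proof (intro set_eqI)
      fix x :: "real ^ 'b"
      show "x \<in> (\<lambda>x. \<chi> i. x $ r i) -` box l u \<longleftrightarrow> x \<in> box (?e l) (?e u)"
        using *[of "\<lambda>i j. l $ i < x $ j \<and> x $ j < u $ i"] by (simp add: mem_box_cart)
    qed
  qed
  then have "emeasure (distr lborel borel (\<lambda>x :: real ^ 'b. \<chi> i. x $ r i)) (box l u)
      = emeasure lborel (box (?e l) (?e u))"
    using meas by (simp add: emeasure_distr)
  also have "\<dots> = (\<Prod>b\<in>Basis. (?e u - ?e l) \<bullet> b)"
    by (rule emeasure_lborel_box) (auto simp: Basis_vec_def inner_axis le')
  also have "(\<Prod>b\<in>Basis. (?e u - ?e l) \<bullet> b) = (\<Prod>i\<in>UNIV. u $ inv r i - l $ inv r i)"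
    by (simp add: prod_Basis_vec)
  also have "\<dots> = (\<Prod>i\<in>UNIV. u $ i - l $ i)"
    using prod.reindex_bij_betw[OF bij_imp_bij_inv[OF r], of "\<lambda>i. u $ i - l $ i"] by simp
  also have "\<dots> = (\<Prod>b\<in>Basis. (u - l) \<bullet> b)"
    by (simp add: prod_Basis_vec)
  finally show "emeasure (distr lborel borel (\<lambda>x :: real ^ 'b. \<chi> i. x $ r i)) (box l u)
      = (\<Prod>b\<in>Basis. (u - l) \<bullet> b)" .
qed simp

section \<open>Differentiable bijections with Jacobian determinant of modulus 1\<close>

text \<open>This is invariance of domain: a continuous injection of a Euclidean space into itself is
  open.\<close>

lemma continuous_on_inv_UNIV:
  fixes R :: "'a::euclidean_space \<Rightarrow> 'a"
  assumes "bij R" "continuous_on UNIV R"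
  shows "continuous_on UNIV (inv R)"
  using continuous_on_inverse_open[of UNIV R "inv R"] assms by (simp add: bij_def)

text \<open>It suffices to compare measures on boxes. \<open>R\<close> maps the preimage
  \<open>?S\<close> of a box injectively onto that box, so by change of variables the box has volume
  equal to the integral over \<open>?S\<close> of the constant 1.\<close>

lemma distr_lborel_volume_preserving_wellorder:
  fixes R :: "real ^ 'n::{finite,wellorder} \<Rightarrow> real ^ 'n::_"
  assumes bij: "bij R" and der: "\<And>y. (R has_derivative R' y) (at y)"
    and det: "\<And>y. \<bar>det (matrix (R' y))\<bar> = 1"
  shows "distr lborel borel R = lborel"
proof (rule lborel_eqI[symmetric])
  fix l u :: "real ^ 'n::_"
  assume le: "\<And>b. b \<in> Basis \<Longrightarrow> l \<bullet> b \<le> u \<bullet> b"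
  let ?S = "R -` box l u"
  have cont: "continuous_on UNIV R"
    using der has_derivative_continuous continuous_at_imp_continuous_on by blast
  have meas: "R \<in> borel_measurable borel"
    by (rule borel_measurable_continuous_onI[OF cont])
  have S: "?S \<in> sets borel"
    using measurable_sets[OF meas, of "box l u"] by simp
  then have S': "?S \<in> sets lebesgue" by simp
  have im: "R ` ?S = box l u"
    using bij by (simp add: bij_is_surj surj_image_vimage_eq)
  have inj: "inj_on R ?S"
    using bij by (meson bij_is_inj inj_on_subset subset_UNIV)
  have der': "(R has_derivative R' x) (at x within ?S)" for x
    using der has_derivative_at_withinI by blast
  \<comment> \<open>That \<open>?S\<close> has finite measure is not known in advance. It follows
    from the image: \<open>box l u\<close> has finite measure, hence the modulus of the determinant,
    which is 1, is integrable over \<open>?S\<close>.\<close>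
  have int: "(\<lambda>x. \<bar>det (matrix (R' x))\<bar>) integrable_on ?S"
    using measurable_differentiable_image_eq[OF S' der' inj] unfolding im by simp
  then have fin: "?S \<in> lmeasurable"
    by (simp add: det lmeasurable_iff_integrable_on)
  have "measure lebesgue (box l u) = measure lebesgue ?S"
    using measure_differentiable_image_eq[OF S' der' inj int] lmeasure_integral[OF fin]
    unfolding im by (simp add: det)
  then have "emeasure lborel ?S = emeasure lborel (box l u)"
    using fin S emeasure_eq_measure2[OF fin] emeasure_eq_measure2[OF lmeasurable_box, of l u]
    by simp
  then show "emeasure (distr lborel borel R) (box l u) = (\<Prod>b\<in>Basis. (u - l) \<bullet> b)"
    using meas le by (simp add: emeasure_distr emeasure_lborel_box)
qed simp

text \<open>Conjugating \<open>R\<close> with the relabelling of coordinates by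
  \<open>'n ordered_copy\<close> reduces the claim to well-ordered index types, since the
  relabelling preserves Lebesgue measure in both directions.\<close>

lemma distr_lborel_volume_preserving:
  fixes R :: "real ^ 'n \<Rightarrow> real ^ 'n"
  assumes bij: "bij R" and diff: "\<And>y. R differentiable (at y)"
    and det: "\<And>y. \<bar>det (jacobian R (at y))\<bar> = 1"
  shows "distr lborel borel R = lborel"
proof -
  define \<phi> :: "real ^ 'n ordered_copy \<Rightarrow> real ^ 'n"
    where "\<phi> = (\<lambda>x. \<chi> i. x $ Abs_ordered_copy i)"
  define \<psi> :: "real ^ 'n \<Rightarrow> real ^ 'n ordered_copy"
    where "\<psi> = (\<lambda>x. \<chi> i. x $ Rep_ordered_copy i)"
  define S where "S = (\<lambda>x. \<psi> (R (\<phi> x)))"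
  let ?R' = "\<lambda>y. frechet_derivative R (at y)"
  have inv: "\<phi> (\<psi> y) = y" "\<psi> (\<phi> x) = x" for x y
    by (simp_all add: \<phi>_def \<psi>_def Abs_ordered_copy_inverse Rep_ordered_copy_inverse vec_eq_iff)
  have bl: "bounded_linear \<phi>" "bounded_linear \<psi>"
    by (auto simp: \<phi>_def \<psi>_def linear_conv_bounded_linear[symmetric] linear_iff vec_eq_iff)
  have cont: "continuous_on UNIV R"
    using diff differentiable_imp_continuous_within continuous_at_imp_continuous_on by blast
  note borel_measurable_continuous_onI[OF cont, measurable]
  have [measurable]: "\<phi> \<in> borel_measurable borel" "\<psi> \<in> borel_measurable borel"
    using bl by (auto intro!: borel_measurable_continuous_onI linear_continuous_on)
  have [measurable]: "S \<in> borel_measurable borel"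
    unfolding S_def by measurable
  have "distr lborel borel S = lborel"
  proof (rule distr_lborel_volume_preserving_wellorder)
    show "bij S"
      unfolding S_def using bij
      by (intro o_bij[of "\<lambda>x. \<psi> (inv R (\<phi> x))"])
        (simp_all add: fun_eq_iff inv bij_is_inj bij_is_surj surj_f_inv_f)
  next
    fix x
    have "(R has_derivative ?R' (\<phi> x)) (at (\<phi> x))"
      using diff by (simp add: frechet_derivative_works[symmetric])
    then have "((\<lambda>x. R (\<phi> x)) has_derivative (\<lambda>h. ?R' (\<phi> x) (\<phi> h))) (at x)"
      by (rule has_derivative_compose[OF bounded_linear_imp_has_derivative[OF bl(1)]])
    then show "(S has_derivative (\<lambda>h. \<psi> (?R' (\<phi> x) (\<phi> h)))) (at x)"
      unfolding S_def by (rule bounded_linear.has_derivative[OF bl(2)])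
  next
    fix x
    \<comment> \<open>Since \<phi> permutes the standard basis vectors, the matrix of the derivative
      of \<open>S\<close> is the Jacobian matrix of \<open>R\<close> with rows and columns
      relabelled alike, so \<open>det_reindex\<close> applies.\<close>
    have ax: "\<phi> (axis j 1) = axis (Rep_ordered_copy j) 1" for j
      by (auto simp: \<phi>_def vec_eq_iff axis_def Abs_ordered_copy_inverse Rep_ordered_copy_inverse)
    have "matrix (\<lambda>h. \<psi> (?R' (\<phi> x) (\<phi> h)))
        = (\<chi> i j. jacobian R (at (\<phi> x)) $ Rep_ordered_copy i $ Rep_ordered_copy j)"
      by (simp add: vec_eq_iff matrix_def jacobian_def ax) (simp add: \<psi>_def)
    then show "\<bar>det (matrix (\<lambda>h. \<psi> (?R' (\<phi> x) (\<phi> h))))\<bar> = 1"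
      using det by (simp add: det_reindex bij_Rep_ordered_copy)
  qed
  moreover have "distr lborel borel \<psi> = lborel" "distr lborel borel \<phi> = lborel"
    unfolding \<phi>_def \<psi>_def
    by (simp_all add: distr_lborel_reindex bij_Rep_ordered_copy bij_Abs_ordered_copy)
  \<comment> \<open>\<open>R\<close> is the composition of \<psi>, \<open>S\<close> and \<phi>,
    applied in this order, and each of the three preserves Lebesgue measure.\<close>
  ultimately have "distr (distr (distr lborel borel \<psi>) borel S) borel \<phi> = lborel"
    by simp
  moreover have "distr (distr (distr lborel borel \<psi>) borel S) borel \<phi> = distr lborel borel R"
    by (simp add: distr_distr comp_def S_def inv)
  ultimately show ?thesis by simp
qed

section \<open>Joint laws and symmetric densities\<close>

text \<open>A product of sigma-finite measures is determined by its values on rectangles, and there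
  the product formula is independence itself.\<close>

lemma distr_pair_indep_rv:
  assumes "prob_space M" "indep_rv M X Y"
    and [measurable]: "X \<in> borel_measurable M" "Y \<in> borel_measurable M"
  shows "distr M (borel \<Otimes>\<^sub>M borel) (\<lambda>\<omega>. (X \<omega>, Y \<omega>)) = distr M borel X \<Otimes>\<^sub>M distr M borel Y"
proof (rule pair_measure_eqI[symmetric])
  interpret prob_space M by fact
  show "sigma_finite_measure (distr M borel X)" "sigma_finite_measure (distr M borel Y)"
    by (auto intro!: prob_space_imp_sigma_finite prob_space_distr)
  fix A B
  assume "A \<in> sets (distr M borel X)" "B \<in> sets (distr M borel Y)"
  then have AB [measurable]: "A \<in> sets borel" "B \<in> sets borel" by simp_all
  have "prob ((X -` A \<inter> space M) \<inter> (Y -` B \<inter> space M))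
      = prob (X -` A \<inter> space M) * prob (Y -` B \<inter> space M)"
    using assms(2) AB unfolding indep_rv_def by (intro indep_setD) auto
  moreover have "(\<lambda>\<omega>. (X \<omega>, Y \<omega>)) -` (A \<times> B) \<inter> space M
      = (X -` A \<inter> space M) \<inter> (Y -` B \<inter> space M)"
    by auto
  ultimately show "emeasure (distr M borel X) A * emeasure (distr M borel Y) B
      = emeasure (distr M (borel \<Otimes>\<^sub>M borel) (\<lambda>\<omega>. (X \<omega>, Y \<omega>))) (A \<times> B)"
    by (simp add: emeasure_distr emeasure_eq_measure ennreal_mult)
qed simp

text \<open>Reflection at 0 preserves both Lebesgue measure and \<open>g\<close>. For a distribution
  function \<open>G\<close> this is 1 - G(t) = G(-t), in a form that avoids subtraction in
  \<open>ennreal\<close>.\<close>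

lemma emeasure_symmetric_density_greaterThan:
  fixes g :: "real \<Rightarrow> ennreal"
  assumes [measurable]: "g \<in> borel_measurable borel" and sym: "\<And>x. g (- x) = g x"
  shows "emeasure (density lborel g) {t<..} = emeasure (density lborel g) {..- t}"
proof -
  have "emeasure (density lborel g) {t<..}
      = (\<integral>\<^sup>+x. g x * indicator {t<..} x \<partial>distr lborel borel uminus)"
    by (simp add: emeasure_density lborel_distr_uminus)
  also have "\<dots> = (\<integral>\<^sup>+x. g x * indicator {t<..} (- x) \<partial>lborel)"
    by (simp add: nn_integral_distr sym)
  \<comment> \<open>Reflection turns the open ray into \<open>{..<- t}\<close>; the endpoint
    \<open>- t\<close> that is added here is a null set.\<close>
  also have "\<dots> = (\<integral>\<^sup>+x. g x * indicator {..- t} x \<partial>lborel)"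
    using AE_lborel_singleton[of "- t"]
    by (intro nn_integral_cong_AE) (auto simp: indicator_def)
  finally show ?thesis
    by (simp add: emeasure_density)
qed

section \<open>The density of \<open>Z\<close>\<close>

theorem mainTheorem1:
  fixes M :: "'m measure"
    and X :: "'m \<Rightarrow> real"
    and Y :: "'m \<Rightarrow> real ^ 'd"
    and G :: "real \<Rightarrow> real"
    and f\<^sub>0 :: "real ^ 'd \<Rightarrow> real"
    and w :: "real ^ 'd \<Rightarrow> real"
    and R :: "real ^ 'd \<Rightarrow> real ^ 'd"
  assumes "prob_space M"
    and "\<exists>g. has_density M X g \<and> symmetric_about_0 g"
    and "G = cdf (distr M borel X)"
    and "has_density M Y f\<^sub>0"
    and "indep_rv M X Y"
    and "w \<in> borel_measurable borel"
    and "\<exists>h. has_density M (\<lambda>\<omega>. w (Y \<omega>)) h \<and> symmetric_about_0 h"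
    and "bij R"
    and "\<And>y. R differentiable (at y)"
    and "\<And>y. f\<^sub>0 y = f\<^sub>0 (R y)"
    and "\<And>y. \<bar>det (jacobian R (at y))\<bar> = 1"
    and "\<And>y. w (R y) = - w y"
  shows "has_density M (\<lambda>\<omega>. if X \<omega> \<le> w (Y \<omega>) then Y \<omega> else inv R (Y \<omega>))
           (\<lambda>z. 2 * f\<^sub>0 z * G (w z))"
proof -
  interpret prob_space M by fact
  obtain g where g: "has_density M X g" "symmetric_about_0 g"
    using assms(2) by blast
  define D where "D = distr M borel X"
  define p where "p = (\<lambda>y. ennreal (f\<^sub>0 y))"
  have [measurable]: "w \<in> borel_measurable borel" by fact
  have [measurable]: "X \<in> borel_measurable M" "Y \<in> borel_measurable M"
      "p \<in> borel_measurable borel" "(\<lambda>x. ennreal (g x)) \<in> borel_measurable borel"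
    using g(1) assms(4) by (auto simp: has_density_def distributed_def p_def)
  have f0: "0 \<le> f\<^sub>0 y" for y
    using assms(4) by (simp add: has_density_def)
  \<comment> \<open>\<open>distr\<close> depends on its target measure only through the measurable
    sets, so \<open>lborel\<close> and \<open>borel\<close> are interchangeable there.\<close>
  have D_density: "D = density lborel (\<lambda>x. ennreal (g x))"
    using g(1) unfolding D_def has_density_def distributed_def
    by (metis distr_cong sets_lborel)
  have Y_density: "distr M borel Y = density lborel p"
    using assms(4) unfolding p_def has_density_def distributed_def
    by (metis distr_cong sets_lborel)
  have real_D: "real_distribution D"
    unfolding D_def by (simp add: real_distribution_distr)
  then interpret D: real_distribution D .
  have G: "ennreal (G t) = emeasure D {..t}" for t
    by (simp add: assms(3) D_def[symmetric] cdf_def D.emeasure_eq_measure)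
  have G_nonneg: "0 \<le> G t" for t
    by (simp add: assms(3) cdf_def)
  have "mono G"
    using D.cdf_nondecreasing by (simp add: assms(3) D_def mono_def)
  then have [measurable]: "G \<in> borel_measurable borel"
    by (rule borel_measurable_mono)
  have tail: "emeasure D {t<..} = ennreal (G (- t))" for t
    using g(2) unfolding G D_density symmetric_about_0_def
    by (intro emeasure_symmetric_density_greaterThan) auto
  have cont: "continuous_on UNIV R"
    using assms(9) differentiable_imp_continuous_within continuous_at_imp_continuous_on by blast
  have [measurable]: "R \<in> borel_measurable borel" "inv R \<in> borel_measurable borel"
    using cont continuous_on_inv_UNIV[OF \<open>bij R\<close> cont]
    by (auto intro: borel_measurable_continuous_onI)
  let ?Z = "\<lambda>\<omega>. if X \<omega> \<le> w (Y \<omega>) then Y \<omega> else inv R (Y \<omega>)"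
  let ?f = "\<lambda>z. ennreal (2 * f\<^sub>0 z * G (w z))"
  have f_eq: "?f z = 2 * (p z * ennreal (G (w z)))" for z
    by (simp add: p_def ennreal_mult' ennreal_mult'' f0 G_nonneg mult.assoc)
  have f_meas: "?f \<in> borel_measurable lborel"
    unfolding f_eq by measurable
  have Z_meas: "?Z \<in> borel_measurable M"
    by measurable
  have "distr M lborel ?Z = density lborel ?f"
  proof (rule measure_eqI)
    fix A
    assume "A \<in> sets (distr M lborel ?Z)"
    then have [measurable]: "A \<in> sets borel" by simp
    \<comment> \<open>The indicator of the event that \<open>Z\<close> lies in \<open>A\<close>, as
      a function of the values of \<open>X\<close> and \<open>Y\<close>, to be integrated against
      their joint law.\<close>
    let ?k = "\<lambda>(x, y). indicator A (if x \<le> w y then y else inv R y) :: ennreal"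
    interpret P: pair_sigma_finite D "distr M borel Y"
      by (intro pair_sigma_finite.intro prob_space_imp_sigma_finite D.prob_space_axioms
        prob_space_distr) measurable
    have "emeasure (distr M lborel ?Z) A = (\<integral>\<^sup>+\<omega>. indicator A (?Z \<omega>) \<partial>M)"
      by (subst nn_integral_distr[of _ _ lborel, symmetric]) simp_all
    also have "\<dots> = (\<integral>\<^sup>+z. ?k z \<partial>distr M (borel \<Otimes>\<^sub>M borel) (\<lambda>\<omega>. (X \<omega>, Y \<omega>)))"
      by (subst nn_integral_distr) auto
    also have "\<dots> = (\<integral>\<^sup>+z. ?k z \<partial>(D \<Otimes>\<^sub>M distr M borel Y))"
      using assms(1,5) by (simp add: D_def distr_pair_indep_rv)
    \<comment> \<open>Tonelli with \<open>X\<close> integrated first: for fixed \<open>y\<close> the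
      integrand is constant on each side of the threshold \<open>w y\<close>, so the inner integral
      reduces to two values of \<open>G\<close>.\<close>
    also have "\<dots> = (\<integral>\<^sup>+y. \<integral>\<^sup>+x. ?k (x, y) \<partial>D \<partial>distr M borel Y)"
      by (rule P.nn_integral_snd[symmetric]) (simp add: D_def)
    also have "\<dots> = (\<integral>\<^sup>+y. indicator A y * ennreal (G (w y))
        + indicator A (inv R y) * ennreal (G (- w y)) \<partial>distr M borel Y)"
    proof (intro nn_integral_cong)
      fix y
      have "(\<integral>\<^sup>+x. ?k (x, y) \<partial>D)
          = (\<integral>\<^sup>+x. indicator A y * indicator {..w y} x + indicator A (inv R y) * indicator {w y<..} x \<partial>D)"
        by (intro nn_integral_cong) (auto simp: indicator_def)
      also have "\<dots> = indicator A y * ennreal (G (w y)) + indicator A (inv R y) * ennreal (G (- w y))"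
        by (simp add: nn_integral_add nn_integral_cmult G tail[unfolded G])
      finally show "(\<integral>\<^sup>+x. ?k (x, y) \<partial>D)
          = indicator A y * ennreal (G (w y)) + indicator A (inv R y) * ennreal (G (- w y))" .
    qed
    also have "\<dots> = (\<integral>\<^sup>+y. p y * (indicator A y * ennreal (G (w y))) \<partial>lborel)
        + (\<integral>\<^sup>+y. p y * (indicator A (inv R y) * ennreal (G (- w y))) \<partial>lborel)"
      by (simp add: Y_density nn_integral_density distrib_left nn_integral_add)
    \<comment> \<open>Writing \<open>lborel\<close> as its image under \<open>R\<close> prepares the
      substitution y = R(z).\<close>
    also have "(\<integral>\<^sup>+y. p y * (indicator A (inv R y) * ennreal (G (- w y))) \<partial>lborel)
        = (\<integral>\<^sup>+y. p y * (indicator A (inv R y) * ennreal (G (- w y))) \<partial>distr lborel borel R)"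
      using assms(8,9,11) by (simp add: distr_lborel_volume_preserving)
    \<comment> \<open>At y = R(z) the density takes the value \<open>p z\<close>,
      \<open>inv R y\<close> becomes \<open>z\<close>, and \<open>- w y\<close> becomes
      \<open>w z\<close>. Both summands are now equal, which gives the factor 2.\<close>
    also have "\<dots> = (\<integral>\<^sup>+z. p z * (indicator A z * ennreal (G (w z))) \<partial>lborel)"
      using \<open>bij R\<close> assms(10)[symmetric] assms(12)
      by (simp add: nn_integral_distr p_def[symmetric] bij_is_inj) (simp add: p_def)
    finally show "emeasure (distr M lborel ?Z) A = emeasure (density lborel ?f) A"
      unfolding f_eq
      by (simp add: emeasure_density mult_2 distrib_right distrib_left nn_integral_add mult_ac)
  qed simp
  with f_meas Z_meas show ?thesis
    by (simp add: has_density_def distributed_def f0 G_nonneg)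
qed

end
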